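(* Let $K$ be a field of characteristic $0$ and let $n\geq 2$, $d\geq 4$ be integers. The following statements hold, as statements about ideals of the polynomial ring $S=K[z_\gamma : |\gamma|=d]$: (1) For all integers $t$ with $2\leq t\leq d-2$ one has \[I_3(\mathrm{Cat}(2,d-2;n))=I_3(\mathrm{Cat}(t,d-t;n)).\] (2) There is a strict inclusion \[I_3(\mathrm{Cat}(1,d-1;n))\subsetneq I_3(\mathrm{Cat}(2,d-2;n)).\]
   Context: Let $K$ be a field and let $n,d$ be positive integers. Multisets $\gamma$ of size $d$ with elements in $\{1,\dots,n\}$ are identified with multiindices $(\gamma_1,\dots,\gamma_n)\in\mathbb{Z}_{\geq 0}^n$ with $|\gamma|=\gamma_1+\cdots+\gamma_n=d$, where $\gamma_i$ is the number of occurrences of $i$ in $\gamma$. The union $\alpha\cup\beta$ of two multisets is taken with multiplicities added, i.e. it corresponds to the sum of multiindices. Let $S=K[z_\gamma : |\gamma|=d]$ be the polynomial ring with one variable $z_\gamma$ for each multiset $\gamma$ of size $d$ with elements in $\{1,\dots,n\}$. For integers $a,b>0$ with $a+b=d$, the generic catalecticant matrix $\mathrm{Cat}(a,b;n)$ is the matrix with entries in $S$ whose rows are indexed by the multisets $\alpha$ of size $a$ and whose columns are indexed by the multisets $\beta$ of size $b$ (with elements in $\{1,\dots,n\}$), and whose entry in position $(\alpha,\beta)$ is $z_{\alpha\cup\beta}$. $I_k(\mathrm{Cat}(a,b;n))\subset S$ denotes the ideal generated by all $k\times k$ minors of $\mathrm{Cat}(a,b;n)$ (it is the zero ideal if there are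 no such minors). *)

theory Defs
  imports
    "HOL-Library.Multiset"
    "HOL-Library.Poly_Mapping"
    "HOL-Algebra.Ideal"
    "Jordan_Normal_Form.Determinant"
begin

definition msets :: "nat \<Rightarrow> nat \<Rightarrow> nat multiset set" where
  "msets n d = {\<gamma>. size \<gamma> = d \<and> set_mset \<gamma> \<subseteq> {1..n}}"

text \<open>
  Polynomials are finitely supported maps from monomials to coefficients, and monomials are
  finitely supported maps from variables to exponents. The type below has one variable for every
  multiset of natural numbers, so \<open>poly_ring n d\<close> restricts it to those polynomials in which
  only the variables indexed by \<open>msets n d\<close> occur; ideals are taken in this ring.
\<close>

type_synonym 'k zpoly = "(nat multiset \<Rightarrow>\<^sub>0 nat) \<Rightarrow>\<^sub>0 'k"

definition zvar :: "nat multiset \<Rightarrow> 'k::comm_ring_1 zpoly" where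
  "zvar \<gamma> = Poly_Mapping.single (Poly_Mapping.single \<gamma> 1) 1"

definition poly_ring :: "nat \<Rightarrow> nat \<Rightarrow> 'k::comm_ring_1 zpoly ring" where
  "poly_ring n d =
     \<lparr>carrier = {p. \<forall>m \<in> Poly_Mapping.keys p. Poly_Mapping.keys m \<subseteq> msets n d},
      monoid.mult = (*), one = 1, ring.zero = 0, add = (+)\<rparr>"

text \<open>
  For a matrix with arbitrary row index set \<open>R\<close> and column index set \<open>C\<close>, a minor is the
  determinant for a choice of \<open>k\<close> distinct rows and \<open>k\<close> distinct columns, in any order. As the
  index sets carry no order, each minor occurs together with its negative (for \<open>k \<ge> 2\<close>), which
  does not affect the ideal generated.
\<close>

definition minors ::
  "nat \<Rightarrow> 'r set \<Rightarrow> 'c set \<Rightarrow> ('r \<Rightarrow> 'c \<Rightarrow> 'a::comm_ring_1) \<Rightarrow> 'a set" where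
  "minors k R C A =
     {det (mat k k (\<lambda>(i, j). A (r i) (c j))) | r c.
        inj_on r {..<k} \<and> r ` {..<k} \<subseteq> R \<and> inj_on c {..<k} \<and> c ` {..<k} \<subseteq> C}"

text \<open>The entry function of \<open>Cat(a,b;n)\<close>; the sizes \<open>a\<close>, \<open>b\<close> and \<open>n\<close> enter through the index sets.\<close>

definition cat_entry :: "nat multiset \<Rightarrow> nat multiset \<Rightarrow> 'k::comm_ring_1 zpoly" where
  "cat_entry \<alpha> \<beta> = zvar (\<alpha> + \<beta>)"

definition cat_ideal :: "nat \<Rightarrow> nat \<Rightarrow> nat \<Rightarrow> nat \<Rightarrow> 'k::comm_ring_1 zpoly set" where
  "cat_ideal k a b n =
     Idl\<^bsub>poly_ring n (a + b)\<^esub> (minors k (msets n a) (msets n b) cat_entry)"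

lemma cring_poly_ring: "cring (poly_ring n d :: 'k::comm_ring_1 zpoly ring)"
proof (rule cringI)
  let ?S = "poly_ring n d :: 'k zpoly ring"
  have mult: "p * q \<in> carrier ?S" if "p \<in> carrier ?S" "q \<in> carrier ?S" for p q
  proof -
    have "Poly_Mapping.keys m \<subseteq> msets n d" if m: "m \<in> Poly_Mapping.keys (p * q)" for m
    proof -
      obtain u v where "m = u + v" "u \<in> Poly_Mapping.keys p" "v \<in> Poly_Mapping.keys q"
        using keys_mult[of p q] m by blast
      then show ?thesis
        using Poly_Mapping.keys_add[of u v] \<open>p \<in> _\<close> \<open>q \<in> _\<close>
        by (fastforce simp: poly_ring_def)
    qed
    then show ?thesis by (simp add: poly_ring_def)
  qed
  have add: "p + q \<in> carrier ?S" if "p \<in> carrier ?S" "q \<in> carrier ?S" for p q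
    using that Poly_Mapping.keys_add[of p q] by (fastforce simp: poly_ring_def)
  have neg: "- p \<in> carrier ?S" if "p \<in> carrier ?S" for p
    using that by (simp add: poly_ring_def in_keys_iff)
  have ops: "x \<otimes>\<^bsub>?S\<^esub> y = x * y" "x \<oplus>\<^bsub>?S\<^esub> y = x + y"
    "\<one>\<^bsub>?S\<^esub> = 1" "\<zero>\<^bsub>?S\<^esub> = 0" for x y
    by (simp_all add: poly_ring_def)
  have zero: "0 \<in> carrier ?S" and one: "1 \<in> carrier ?S"
    by (simp_all add: poly_ring_def)
  show "abelian_group ?S"
  proof (rule abelian_groupI, unfold ops)
    fix p q r assume pqr: "p \<in> carrier ?S" "q \<in> carrier ?S" "r \<in> carrier ?S"
    show "p + q \<in> carrier ?S" using pqr(1,2) by (rule add)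
    show "p + q + r = p + (q + r)" by (rule add.assoc)
  next
    fix p q assume "p \<in> carrier ?S" "q \<in> carrier ?S"
    show "p + q = q + p" by (rule add.commute)
  next
    fix p assume p: "p \<in> carrier ?S"
    show "0 + p = p" by (rule add_0)
    show "\<exists>q\<in>carrier ?S. q + p = 0" using neg[OF p] by (intro bexI[of _ "- p"]) simp_all
  qed (fact zero add)+
  show "comm_monoid ?S"
  proof (rule comm_monoidI, unfold ops)
    fix p q r :: "'k zpoly"
    show "p * q * r = p * (q * r)" by (rule mult.assoc)
    show "p * q = q * p" by (rule mult.commute)
    show "1 * p = p" by (rule mult_1_left)
  qed (fact one mult)+
  fix p q r :: "'k zpoly"
  show "(p \<oplus>\<^bsub>?S\<^esub> q) \<otimes>\<^bsub>?S\<^esub> r = p \<otimes>\<^bsub>?S\<^esub> r \<oplus>\<^bsub>?S\<^esub> q \<otimes>\<^bsub>?S\<^esub> r"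
    unfolding ops by (rule distrib_right)
qed

lemma cat_entry_in_poly_ring:
  assumes "\<alpha> \<in> msets n a" "\<beta> \<in> msets n b"
  shows "cat_entry \<alpha> \<beta> \<in> carrier (poly_ring n (a + b))"
  using assms by (auto simp: cat_entry_def zvar_def poly_ring_def msets_def)

end

theory Submission
  imports Defs
begin

text \<open>
  Everything follows from the inclusion
  \[ I_3(\mathrm{Cat}(a, b + 1; n)) \subseteq I_3(\mathrm{Cat}(a + 1, b; n)) \quad (b \ge 2), \]
  which is \<open>cat_ideal_shift\<close>. Iterating it, every \<open>I\<^sub>3(Cat(t, d - t))\<close> with \<open>2 \<le> t \<le> d - 2\<close> lies between
  \<open>I\<^sub>3(Cat(2, d - 2))\<close> and \<open>I\<^sub>3(Cat(d - 2, 2))\<close>; these two ideals agree because the matrices are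
  transposes of each other. The step from \<open>1\<close> to \<open>2\<close> is also covered, since \<open>d - 1 \<ge> 3\<close>.

  For the inclusion, fix the three row indices of a minor of \<open>Cat(a, b + 1)\<close> and regard the minor
  as a function \<open>f\<close> of its three column indices. Distribute three letters \<open>x\<close>, \<open>y\<close>, \<open>z\<close> over three
  columns of size \<open>b\<close> in all six ways and add up the values of \<open>f\<close>: since
  the letters may as well be attached to the rows, the sum is a sum of minors of \<open>Cat(a + 1, b)\<close>
  (\<open>sum_cat_minor_move_letters\<close>). It remains to see that these six-term relations alone force every value of \<open>f\<close>
  into the ideal (\<open>all_values_in_J\<close>), a statement in which determinants no longer occur.

  In characteristic \<open>0\<close> the relations may be polarised, so the latter can be understood for columns
  \<open>p\<^sup>B\<close>, \<open>q\<^sup>B\<close>, \<open>r\<^sup>B\<close> with \<open>B = b + 1 \<ge> 3\<close>. Write \<open>\<equiv>\<close> for congruence modulo the ideal. Distributing \<open>p\<close>, \<open>p\<close>, \<open>p\<close>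
  shows that \<open>f \<equiv> 0\<close> on triples whose three columns share a letter. Up to such triples, distributing \<open>p\<close>, \<open>p\<close>, \<open>q\<close>
  over \<open>p\<^sup>B\<^sup>-\<^sup>2q\<close>, \<open>q\<^sup>B\<^sup>-\<^sup>2r\<close>, \<open>r\<^sup>B\<^sup>-\<^sup>1\<close> shows that moving one letter from each column cyclically to another
  gives \<open>f \<equiv> 0\<close>, and distributing them over \<open>p\<^sup>B\<^sup>-\<^sup>2r\<close>, \<open>q\<^sup>B\<^sup>-\<^sup>1\<close>, \<open>r\<^sup>B\<^sup>-\<^sup>1\<close> then
  gives the same for exchanging one letter between two columns. Finally, distributing \<open>p\<close>, \<open>q\<close>, \<open>r\<close>
  over \<open>p\<^sup>B\<^sup>-\<^sup>1\<close>, \<open>q\<^sup>B\<^sup>-\<^sup>1\<close>, \<open>r\<^sup>B\<^sup>-\<^sup>1\<close> yields \<open>f(p\<^sup>B, q\<^sup>B, r\<^sup>B)\<close> plus three exchanges and two cyclic moves, so it is \<open>\<equiv> 0\<close>.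
  The lemmas below carry this out for arbitrary columns: a power of \<open>p\<close> becomes a column
  in which three letters \<open>p\<close>, \<open>p'\<close>, \<open>p''\<close> are singled out, and sums over these letters replace polarisation.

  The inclusion for \<open>t = 1\<close> is strict because of the monomial \<open>z\<^sub>\<gamma>\<^sup>3\<close> with \<open>\<gamma> = 1\<^sup>d\<^sup>-\<^sup>22\<^sup>2\<close>: in a minor of
  \<open>Cat(1, d - 1)\<close> one of the three rows belongs to a letter other than \<open>1\<close> and \<open>2\<close>, so
  no power of \<open>z\<^sub>\<gamma>\<close> occurs in an element of the ideal,
  whereas \<open>z\<^sub>\<gamma>\<^sup>3\<close> is the antidiagonal term of a Hankel minor of \<open>Cat(2, d - 2)\<close>.
\<close>

section \<open>Three by three minors as six-term expressions\<close>

lemma det_mat_3: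
  "det (mat 3 3 h) = h (0,0) * h (1,1) * h (2,2) + h (0,1) * h (1,2) * h (2,0) + h (0,2) * h (1,0) * h (2,1)
     - h (0,0) * h (1,2) * h (2,1) - h (0,1) * h (1,0) * h (2,2) - h (0,2) * h (1,1) * h (2,0)"
  for h :: "nat \<times> nat \<Rightarrow> 'a::comm_ring_1"
proof -
  have 3: "{0..<3} = {0, 1, 2::nat}" by auto
  have f: "finite {1, 2::nat}" "0 \<notin> {1, 2::nat}" "finite {2::nat}" "1 \<notin> {2::nat}" by auto
  show ?thesis
    unfolding det_def'[OF mat_carrier] 3 sum_over_permutations_insert[OF f(1,2)]
      sum_over_permutations_insert[OF f(3,4)] permutes_sing
    by (simp add: sign_swap_id permutation_swap_id sign_compose sign_id transpose_def algebra_simps)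
qed

definition cat_minor :: "nat multiset \<Rightarrow> nat multiset \<Rightarrow> nat multiset \<Rightarrow>
    nat multiset \<Rightarrow> nat multiset \<Rightarrow> nat multiset \<Rightarrow> 'k::comm_ring_1 zpoly" where
  "cat_minor \<alpha> \<alpha>' \<alpha>'' \<beta> \<beta>' \<beta>'' =
     cat_entry \<alpha> \<beta> * cat_entry \<alpha>' \<beta>' * cat_entry \<alpha>'' \<beta>''
   + cat_entry \<alpha> \<beta>' * cat_entry \<alpha>' \<beta>'' * cat_entry \<alpha>'' \<beta>
   + cat_entry \<alpha> \<beta>'' * cat_entry \<alpha>' \<beta> * cat_entry \<alpha>'' \<beta>'
   - cat_entry \<alpha> \<beta> * cat_entry \<alpha>' \<beta>'' * cat_entry \<alpha>'' \<beta>'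
   - cat_entry \<alpha> \<beta>' * cat_entry \<alpha>' \<beta> * cat_entry \<alpha>'' \<beta>''
   - cat_entry \<alpha> \<beta>'' * cat_entry \<alpha>' \<beta>' * cat_entry \<alpha>'' \<beta>"

text \<open>The explicit six-term form replaces determinants of matrices in all later arguments.\<close>

lemma minors_3_cat_entry:
  "minors 3 R C cat_entry = {cat_minor \<alpha> \<alpha>' \<alpha>'' \<beta> \<beta>' \<beta>'' | \<alpha> \<alpha>' \<alpha>'' \<beta> \<beta>' \<beta>''.
     distinct [\<alpha>, \<alpha>', \<alpha>''] \<and> {\<alpha>, \<alpha>', \<alpha>''} \<subseteq> R \<and> distinct [\<beta>, \<beta>', \<beta>''] \<and> {\<beta>, \<beta>', \<beta>''} \<subseteq> C}"
  (is "?L = ?M")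
proof
  have 3: "{..<3} = {0, 1, 2::nat}" by auto
  show "?L \<subseteq> ?M"
  proof
    fix u assume "u \<in> ?L"
    then obtain r c where u: "u = det (mat 3 3 (\<lambda>(i, j). cat_entry (r i) (c j)))"
      and rc: "inj_on r {..<3}" "r ` {..<3} \<subseteq> R" "inj_on c {..<3}" "c ` {..<3} \<subseteq> C"
      unfolding minors_def by blast
    have "u = cat_minor (r 0) (r 1) (r 2) (c 0) (c 1) (c 2)"
      unfolding u det_mat_3 cat_minor_def by simp
    moreover have "distinct [r 0, r 1, r 2]" "{r 0, r 1, r 2} \<subseteq> R" "distinct [c 0, c 1, c 2]" "{c 0, c 1, c 2} \<subseteq> C"
      using rc by (auto simp: 3)
    ultimately show "u \<in> ?M" by blast
  qed
  show "?M \<subseteq> ?L"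
  proof clarify
    fix \<alpha> \<alpha>' \<alpha>'' \<beta> \<beta>' \<beta>''
    assume ab: "distinct [\<alpha>, \<alpha>', \<alpha>'']" "{\<alpha>, \<alpha>', \<alpha>''} \<subseteq> R" "distinct [\<beta>, \<beta>', \<beta>'']" "{\<beta>, \<beta>', \<beta>''} \<subseteq> C"
    let ?r = "(!) [\<alpha>, \<alpha>', \<alpha>'']" and ?c = "(!) [\<beta>, \<beta>', \<beta>'']"
    have "cat_minor \<alpha> \<alpha>' \<alpha>'' \<beta> \<beta>' \<beta>'' = det (mat 3 3 (\<lambda>(i, j). cat_entry (?r i) (?c j)))"
      unfolding det_mat_3 cat_minor_def by (simp add: numeral_2_eq_2)
    moreover have "inj_on ?r {..<3}" "inj_on ?c {..<3}" "?r ` {..<3} \<subseteq> R" "?c ` {..<3} \<subseteq> C"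
      using ab by (auto simp: 3 numeral_2_eq_2)
    ultimately show "cat_minor \<alpha> \<alpha>' \<alpha>'' \<beta> \<beta>' \<beta>'' \<in> ?L"
      unfolding minors_def by blast
  qed
qed

section \<open>Ideals of the polynomial ring\<close>

lemma poly_ring_sel [simp]:
  "x \<otimes>\<^bsub>poly_ring n d\<^esub> y = x * y" "x \<oplus>\<^bsub>poly_ring n d\<^esub> y = x + y"
  "\<one>\<^bsub>poly_ring n d\<^esub> = 1" "\<zero>\<^bsub>poly_ring n d\<^esub> = 0"
  by (simp_all add: poly_ring_def)

lemma ring_poly_ring: "ring (poly_ring n d :: 'k::comm_ring_1 zpoly ring)"
  using cring_poly_ring by (rule cring.axioms)

lemma const_in_poly_ring: "Poly_Mapping.single 0 c \<in> carrier (poly_ring n d)"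
  by (auto simp: poly_ring_def)

lemma ideal_closed:
  assumes "ideal I (poly_ring n d :: 'k::comm_ring_1 zpoly ring)"
  shows "u \<in> I \<Longrightarrow> v \<in> I \<Longrightarrow> u + v \<in> I" "u \<in> I \<Longrightarrow> v \<in> I \<Longrightarrow> u - v \<in> I"
    "u \<in> I \<Longrightarrow> Poly_Mapping.single 0 c * u \<in> I" "0 \<in> I"
proof -
  interpret ideal I "poly_ring n d :: 'k zpoly ring" by (fact assms)
  show plus: "u \<in> I \<Longrightarrow> v \<in> I \<Longrightarrow> u + v \<in> I" for u v
    using additive_subgroup.a_closed[OF is_additive_subgroup, of u v] by simp
  show const: "u \<in> I \<Longrightarrow> Poly_Mapping.single 0 c * u \<in> I" for u c
    using I_l_closed[OF _ const_in_poly_ring] by simp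
  have "Poly_Mapping.single 0 (- 1) * v = - v"
    by (simp add: single_uminus)
  then show "u \<in> I \<Longrightarrow> v \<in> I \<Longrightarrow> u - v \<in> I"
    using plus[of u "- v"] const[of v "- 1"] by simp
  show "0 \<in> I" using additive_subgroup.zero_closed[OF is_additive_subgroup] by simp
qed

lemma ideal_cancel_numeral:
  fixes u :: "'k::field_char_0 zpoly"
  assumes "ideal I (poly_ring n d :: 'k zpoly ring)" "numeral k * u \<in> I"
  shows "u \<in> I"
proof -
  have "Poly_Mapping.single 0 (1 / numeral k) * (numeral k * u) = u"
    by (simp flip: single_numeral mult.assoc add: mult_single)
  then show ?thesis using ideal_closed(3)[OF assms] by metis
qed

lemma minors_in_poly_ring:
  "minors 3 (msets n a) (msets n b) cat_entry \<subseteq> carrier (poly_ring n (a + b) :: 'k::comm_ring_1 zpoly ring)"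
proof -
  interpret cring "poly_ring n (a + b) :: 'k zpoly ring" by (rule cring_poly_ring)
  have "x * y \<in> carrier (poly_ring n (a + b))" "x + y \<in> carrier (poly_ring n (a + b))"
    "x - y \<in> carrier (poly_ring n (a + b))"
    if "x \<in> carrier (poly_ring n (a + b))" "y \<in> carrier (poly_ring n (a + b))" for x y :: "'k zpoly"
    using that m_closed[of x y] a_closed[of x y] ideal_closed(2)[OF oneideal that] by simp_all
  note closed = this
  show ?thesis
    unfolding minors_3_cat_entry cat_minor_def
    by clarify (intro closed cat_entry_in_poly_ring; simp)
qed

lemma ideal_cat_ideal: "ideal (cat_ideal 3 a b n) (poly_ring n (a + b) :: 'k::comm_ring_1 zpoly ring)"
  unfolding cat_ideal_def by (intro ring.genideal_ideal ring_poly_ring minors_in_poly_ring)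

text \<open>
  Repeated rows or columns are harmless, as such a minor is zero. This allows letters to
  be moved around without tracking whether the resulting indices stay distinct.
\<close>

lemma cat_minor_in_cat_ideal:
  assumes "{\<alpha>, \<alpha>', \<alpha>''} \<subseteq> msets n a" "{\<beta>, \<beta>', \<beta>''} \<subseteq> msets n b"
  shows "cat_minor \<alpha> \<alpha>' \<alpha>'' \<beta> \<beta>' \<beta>'' \<in> (cat_ideal 3 a b n :: 'k::comm_ring_1 zpoly set)"
proof (cases "distinct [\<alpha>, \<alpha>', \<alpha>''] \<and> distinct [\<beta>, \<beta>', \<beta>'']")
  case True
  then have "cat_minor \<alpha> \<alpha>' \<alpha>'' \<beta> \<beta>' \<beta>'' \<in> minors 3 (msets n a) (msets n b) (cat_entry :: _ \<Rightarrow> _ \<Rightarrow> 'k zpoly)"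
    using assms unfolding minors_3_cat_entry by blast
  then show ?thesis
    unfolding cat_ideal_def using ring.genideal_self[OF ring_poly_ring minors_in_poly_ring] by blast
next
  case False
  then have "cat_minor \<alpha> \<alpha>' \<alpha>'' \<beta> \<beta>' \<beta>'' = (0 :: 'k zpoly)"
    by (auto simp: cat_minor_def algebra_simps)
  then show ?thesis using ideal_closed(4)[OF ideal_cat_ideal] by simp
qed

lemma cat_ideal_least:
  assumes "ideal I (poly_ring n (a + b) :: 'k::comm_ring_1 zpoly ring)"
    and "\<And>\<alpha> \<alpha>' \<alpha>'' \<beta> \<beta>' \<beta>''. distinct [\<alpha>, \<alpha>', \<alpha>''] \<Longrightarrow> {\<alpha>, \<alpha>', \<alpha>''} \<subseteq> msets n a \<Longrightarrow>
        {\<beta>, \<beta>', \<beta>''} \<subseteq> msets n b \<Longrightarrow> cat_minor \<alpha> \<alpha>' \<alpha>'' \<beta> \<beta>' \<beta>'' \<in> I"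
  shows "cat_ideal 3 a b n \<subseteq> I"
  unfolding cat_ideal_def
  by (rule ring.genideal_minimal[OF ring_poly_ring assms(1)]) (use assms(2) in \<open>auto simp: minors_3_cat_entry\<close>)

lemma cat_ideal_transpose: "(cat_ideal 3 a b n :: 'k::comm_ring_1 zpoly set) = cat_ideal 3 b a n"
proof -
  have "(cat_ideal 3 a b n :: 'k zpoly set) \<subseteq> cat_ideal 3 b a n" for a b
  proof (rule cat_ideal_least)
    show "ideal (cat_ideal 3 b a n) (poly_ring n (a + b) :: 'k zpoly ring)"
      using ideal_cat_ideal[of b a n] by (simp add: add.commute)
    fix \<alpha> \<alpha>' \<alpha>'' \<beta> \<beta>' \<beta>''
    assume "{\<alpha>, \<alpha>', \<alpha>''} \<subseteq> msets n a" "{\<beta>, \<beta>', \<beta>''} \<subseteq> msets n b"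
    moreover have "cat_minor \<alpha> \<alpha>' \<alpha>'' \<beta> \<beta>' \<beta>'' = (cat_minor \<beta> \<beta>' \<beta>'' \<alpha> \<alpha>' \<alpha>'' :: 'k zpoly)"
      by (simp add: cat_minor_def cat_entry_def algebra_simps)
    ultimately show "cat_minor \<alpha> \<alpha>' \<alpha>'' \<beta> \<beta>' \<beta>'' \<in> (cat_ideal 3 b a n :: 'k zpoly set)"
      using cat_minor_in_cat_ideal by metis
  qed
  then show ?thesis by blast
qed

section \<open>Moving letters from columns to rows\<close>

lemma cat_entry_add_mset:
  "cat_entry (add_mset x \<alpha>) \<beta> = (cat_entry \<alpha> (add_mset x \<beta>) :: 'k::comm_ring_1 zpoly)"
  by (simp add: cat_entry_def)

text \<open>
  Both sides are sums over pairs of permutations: a term matches row \<open>i\<close> with column \<open>\<sigma> i\<close>, with the sign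
  of \<open>\<sigma>\<close>, and gives this product one of the letters. As all six distributions of the letters are added up, it does not
  matter whether a letter enters a product through its column or through its row.
\<close>

lemma sum_cat_minor_move_letters:
  "cat_minor \<alpha> \<alpha>' \<alpha>'' (add_mset x A) (add_mset y B) (add_mset z C)
  + cat_minor \<alpha> \<alpha>' \<alpha>'' (add_mset x A) (add_mset z B) (add_mset y C)
  + cat_minor \<alpha> \<alpha>' \<alpha>'' (add_mset y A) (add_mset x B) (add_mset z C)
  + cat_minor \<alpha> \<alpha>' \<alpha>'' (add_mset y A) (add_mset z B) (add_mset x C)
  + cat_minor \<alpha> \<alpha>' \<alpha>'' (add_mset z A) (add_mset x B) (add_mset y C)
  + cat_minor \<alpha> \<alpha>' \<alpha>'' (add_mset z A) (add_mset y B) (add_mset x C)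
  = cat_minor (add_mset x \<alpha>) (add_mset y \<alpha>') (add_mset z \<alpha>'') A B C
  + cat_minor (add_mset x \<alpha>) (add_mset z \<alpha>') (add_mset y \<alpha>'') A B C
  + cat_minor (add_mset y \<alpha>) (add_mset x \<alpha>') (add_mset z \<alpha>'') A B C
  + cat_minor (add_mset y \<alpha>) (add_mset z \<alpha>') (add_mset x \<alpha>'') A B C
  + cat_minor (add_mset z \<alpha>) (add_mset x \<alpha>') (add_mset y \<alpha>'') A B C
  + cat_minor (add_mset z \<alpha>) (add_mset y \<alpha>') (add_mset x \<alpha>'') A B C"
  unfolding cat_minor_def cat_entry_add_mset by (simp add: algebra_simps)

section \<open>Consequences of the six-term relations\<close>

text \<open>
  Think of \<open>f\<close> as the coefficients, modulo \<open>J\<close>, of a polynomial \<open>F(u, v, w)\<close> of degree \<open>m + 1\<close> in each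
  of three vectors. The six-term relation is the polarised form of
  \<open>(t \<cdot> \<partial>\<^sub>u)(t \<cdot> \<partial>\<^sub>v)(t \<cdot> \<partial>\<^sub>w)F = 0\<close> for all vectors \<open>t\<close>. It is symmetric in the three vectors, so that each
  consequence of it holds with the arguments of \<open>f\<close> permuted as well. The two cancellation
  rules provide the denominators that arise from summing over pairs and triples of letters.
\<close>

locale symmetrised_relations =
  fixes n m :: nat and J :: "'b::ab_group_add set"
    and f :: "nat multiset \<Rightarrow> nat multiset \<Rightarrow> nat multiset \<Rightarrow> 'b"
  assumes add: "u \<in> J \<Longrightarrow> v \<in> J \<Longrightarrow> u + v \<in> J"
    and diff: "u \<in> J \<Longrightarrow> v \<in> J \<Longrightarrow> u - v \<in> J"
    and half: "u + u \<in> J \<Longrightarrow> u \<in> J"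
    and third: "u + u + u \<in> J \<Longrightarrow> u \<in> J"
    and relation: "A \<in> msets n m \<Longrightarrow> B \<in> msets n m \<Longrightarrow> C \<in> msets n m
      \<Longrightarrow> {x, y, z} \<subseteq> {1..n} \<Longrightarrow>
        f (add_mset x A) (add_mset y B) (add_mset z C) + f (add_mset x A) (add_mset z B) (add_mset y C)
      + f (add_mset y A) (add_mset x B) (add_mset z C) + f (add_mset y A) (add_mset z B) (add_mset x C)
      + f (add_mset z A) (add_mset x B) (add_mset y C) + f (add_mset z A) (add_mset y B) (add_mset x C) \<in> J"
begin

lemma cancel: "u + v \<in> J \<Longrightarrow> v \<in> J \<Longrightarrow> u \<in> J"
  using diff[of "u + v" v] by simp

lemma swap_first: "symmetrised_relations n m J (\<lambda>A B C. f B A C)"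
proof
  fix A B C and x y z
  assume "A \<in> msets n m" "B \<in> msets n m" "C \<in> msets n m" "{x, y, z} \<subseteq> {1..n}"
  from relation[OF this(2,1,3,4)]
  show "f (add_mset y B) (add_mset x A) (add_mset z C) + f (add_mset z B) (add_mset x A) (add_mset y C)
      + f (add_mset x B) (add_mset y A) (add_mset z C) + f (add_mset z B) (add_mset y A) (add_mset x C)
      + f (add_mset x B) (add_mset z A) (add_mset y C) + f (add_mset y B) (add_mset z A) (add_mset x C) \<in> J"
    by (simp add: algebra_simps)
qed (fact add diff half third)+

lemma swap_last: "symmetrised_relations n m J (\<lambda>A B C. f A C B)"
proof
  fix A B C and x y z
  assume "A \<in> msets n m" "B \<in> msets n m" "C \<in> msets n m" "{x, y, z} \<subseteq> {1..n}"
  from relation[OF this(1,3,2,4)]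
  show "f (add_mset x A) (add_mset z C) (add_mset y B) + f (add_mset x A) (add_mset y C) (add_mset z B)
      + f (add_mset y A) (add_mset z C) (add_mset x B) + f (add_mset y A) (add_mset x C) (add_mset z B)
      + f (add_mset z A) (add_mset y C) (add_mset x B) + f (add_mset z A) (add_mset x C) (add_mset y B) \<in> J"
    by (simp add: algebra_simps)
qed (fact add diff half third)+

text \<open>
  The relation for two letters \<open>x\<close>, \<open>y\<close> of \<open>P\<close> and one letter \<open>q\<close> of \<open>Q\<close>, distributed over what is left of \<open>P\<close>, \<open>Q\<close>, \<open>R\<close>
  after \<open>r\<close> has moved to the first block, has six terms. In four of them \<open>q\<close> is outside the first block; they exchange
  \<open>x\<close> or \<open>y\<close> with \<open>r\<close>, or move \<open>x\<close> or \<open>y\<close>, \<open>q\<close> and \<open>r\<close> cyclically. In the other two each block has a letter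
  from \<open>P\<close>, provided that a third letter of \<open>P\<close> remains in the first block; summed over the three letters,
  those terms give an element of \<open>J\<close>, by the relation for \<open>p\<close>, \<open>p'\<close>, \<open>p''\<close>.
\<close>

lemma swap_plus_cycle:
  assumes "P = {#p, p', p''#} + P'" "Q = add_mset q Q'" "R = add_mset r R'"
    and "P \<in> msets n (Suc m)" "Q \<in> msets n (Suc m)" "R \<in> msets n (Suc m)"
  defines "a \<equiv> \<lambda>x. f (add_mset r (P - {#x#})) Q (add_mset x R')
                  + f (add_mset r (P - {#x#})) (add_mset x Q') (add_mset q R')"
  shows "a p + a p' + a p'' \<in> J"
proof -
  \<comment> \<open>the terms in which each block has a letter from \<open>P\<close>\<close>
  define h where "h x y = f (add_mset q (add_mset r (P - {#x, y#}))) (add_mset x Q') (add_mset y R')" for x y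
  have m: "Q' \<in> msets n m" "R' \<in> msets n m" "{p,p',p'',q,r} \<subseteq> {1..n}"
    "{#r, p#} + P' \<in> msets n m" "{#r, p'#} + P' \<in> msets n m" "{#r, p''#} + P' \<in> msets n m"
    "{#r, q#} + P' \<in> msets n m"
    using assms(1-6) by (auto simp: msets_def)
  have 1: "a x + a y + h x y + h y x \<in> J" if "P = {#x, y, z#} + P'" "z \<in> {p,p',p''}" "{x,y} \<subseteq> {1..n}" for x y z
  proof -
    have "{#r, z#} + P' \<in> msets n m" using m that by blast
    from relation[OF this m(1,2), of x y q] that m
    show ?thesis by (simp add: a_def h_def assms(2) algebra_simps add_mset_commute)
  qed
  have H: "h p p' + h p p'' + h p' p + h p' p'' + h p'' p + h p'' p' \<in> J"
    using relation[OF m(7,1,2), of p p' p''] m(3)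
    by (simp add: h_def assms(1) algebra_simps add_mset_commute)
  \<comment> \<open>the three pairs of letters cover each letter twice and each ordered pair once\<close>
  have "(a p + a p' + a p'') + (a p + a p' + a p'') \<in> J"
    using add[OF add[OF 1[of p p' p''] 1[of p p'' p']] 1[of p' p'' p]] m(3)
    by - (rule cancel[OF _ H], simp add: assms(1) algebra_simps add_mset_commute)
  then show ?thesis by (rule half)
qed

text \<open>
  Here \<open>c x y\<close> moves \<open>y\<close> to the first, \<open>r\<close> to the second and \<open>x\<close> to the third block. Starting from \<open>P\<close>, \<open>Q\<close>, \<open>R\<close>
  without \<open>x\<close>, \<open>x'\<close>, without \<open>y\<close>, \<open>y'\<close> and without \<open>r\<close>, with \<open>y\<close> added to the first and \<open>r\<close> to the second
  block, distribute \<open>x\<close>, \<open>x'\<close>, \<open>y'\<close>. If \<open>y'\<close> joins the second block, the terms are \<open>c x y\<close> and \<open>c x' y\<close>.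
  If it joins the first block, a letter of \<open>P\<close> is in each block, and if it joins the third block, a letter
  of \<open>Q\<close> is; both kinds disappear after summation over three letters of \<open>P\<close>, respectively \<open>Q\<close>.
\<close>

lemma cycle:
  assumes "P = {#p, p', p''#} + P'" "Q = {#q, q', q''#} + Q'" "R = add_mset r R'"
    and "P \<in> msets n (Suc m)" "Q \<in> msets n (Suc m)" "R \<in> msets n (Suc m)"
  defines "c \<equiv> \<lambda>x y. f (add_mset y (P - {#x#})) (add_mset r (Q - {#y#})) (add_mset x R')"
  defines "s \<equiv> \<lambda>y. c p y + c p' y + c p'' y"
  shows "s q + s q' + s q'' \<in> J"
proof -
  \<comment> \<open>\<open>h\<close> has a letter of \<open>P\<close> in each block, \<open>g\<close> a letter of \<open>Q\<close>\<close>
  define h where "h x x' y y' = f (add_mset y (add_mset y' (P - {#x, x'#})))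
    (add_mset r (add_mset x (Q - {#y, y'#}))) (add_mset x' R')" for x x' y y'
  define g where "g x y y' = f (add_mset y (P - {#x#}))
    (add_mset r (add_mset x (Q - {#y, y'#}))) (add_mset y' R')" for x y y'
  have m: "R' \<in> msets n m" "{p,p',p'',q,q',q'',r} \<subseteq> {1..n}"
    using assms(1-6) by (auto simp: msets_def)
  have P: "{#x, y#} + P' \<in> msets n m" if "x \<in> {1..n}" "y \<in> {1..n}" for x y
    using assms(1,4) that by (auto simp: msets_def)
  have Q: "{#x, y#} + Q' \<in> msets n m" if "x \<in> {1..n}" "y \<in> {1..n}" for x y
    using assms(2,5) that by (auto simp: msets_def)
  have 3: "s y + g p y y' + g p' y y' + g p'' y y' \<in> J"
    if y: "Q = {#y, y', y''#} + Q'" "{y,y',y''} \<subseteq> {1..n}" for y y' y''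
  proof -
    have 1: "h x x' y y' + h x' x y y' + c x y + c x' y + g x y y' + g x' y y' \<in> J"
      if "P = {#x, x', x''#} + P'" "{x,x',x''} \<subseteq> {1..n}" for x x' x''
      using relation[OF P[of y x''] Q[of r y''] m(1), of x x' y'] that y m(2)
      by (simp add: c_def g_def h_def algebra_simps add_mset_commute)
    have H: "h p p' y y' + h p p'' y y' + h p' p y y' + h p' p'' y y' + h p'' p y y' + h p'' p' y y' \<in> J"
      using relation[OF P[of y y'] Q[of r y''] m(1), of p p' p''] m(2) y
      by (simp add: h_def assms(1) algebra_simps add_mset_commute)
    have "(s y + g p y y' + g p' y y' + g p'' y y') + (s y + g p y y' + g p' y y' + g p'' y y') \<in> J"
      using add[OF add[OF 1[of p p' p''] 1[of p p'' p']] 1[of p' p'' p]] m(2)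
      by - (rule cancel[OF _ H], simp add: assms(1) s_def algebra_simps add_mset_commute)
    then show ?thesis by (rule half)
  qed
  have 4: "g x q q' + g x q q'' + g x q' q + g x q' q'' + g x q'' q + g x q'' q' \<in> J"
    if x: "x \<in> {p, p', p''}" for x
  proof -
    obtain y y' where "P - {#x#} = {#y, y'#} + P'" "{x,y,y'} \<subseteq> {1..n}"
      using x m(2) by (auto simp: assms(1) add_mset_commute)
    then show ?thesis
    using relation[OF P[of y y'] Q[of r x] m(1), of q q' q''] m(2) x
      by (simp add: g_def assms(2) algebra_simps add_mset_commute)
  qed
  have "(s q + s q' + s q'') + (s q + s q' + s q'') \<in> J"
    using add[OF add[OF add[OF 3[of q q' q''] 3[of q q'' q']] add[OF 3[of q' q q''] 3[of q' q'' q]]]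
        add[OF 3[of q'' q q'] 3[of q'' q' q]]] m(2)
    by - (rule cancel[OF _ add[OF add[OF 4[of p] 4[of p']] 4[of p'']]], simp_all add: assms(2) algebra_simps add_mset_commute)
  then show ?thesis by (rule half)
qed

text \<open>
  The relation for \<open>x\<close>, \<open>y\<close>, \<open>r\<close> distributed over \<open>P\<close>, \<open>Q\<close>, \<open>R\<close> without these letters consists of \<open>f P Q R\<close>, three
  exchanges and two cyclic moves. Summed over the nine choices of \<open>x\<close> and \<open>y\<close>, each of the latter five
  gives an element of \<open>J\<close>, so \<open>9 f P Q R\<close> is in \<open>J\<close>.
  The bound on \<open>m\<close> is sharp: for blocks of size \<open>2\<close> and vectors in the plane, \<open>F = [u v][v w][w u]\<close>
  (products of determinants) is a nonzero polynomial that satisfies the relations.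
\<close>

lemma all_values_in_J:
  assumes "m \<ge> 2" and "P \<in> msets n (Suc m)" "Q \<in> msets n (Suc m)" "R \<in> msets n (Suc m)"
  shows "f P Q R \<in> J"
proof -
  have ex3: "\<exists>x x' x'' X'. X = {#x, x', x''#} + X'" if "X \<in> msets n (Suc m)" for X
  proof -
    have "size X = Suc (Suc (Suc (m - 2)))"
      using that assms(1) by (simp add: msets_def)
    moreover from this obtain x X1 where "X = add_mset x X1"
      by (blast dest: size_eq_Suc_imp_eq_union)
    moreover from calculation obtain y X2 where "X1 = add_mset y X2"
      by (auto dest: size_eq_Suc_imp_eq_union)
    moreover from calculation obtain z X3 where "X2 = add_mset z X3"
      by (auto dest: size_eq_Suc_imp_eq_union)
    ultimately show ?thesis by auto
  qed
  obtain p p' p'' P' q q' q'' Q' r R' where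
    PQR: "P = {#p, p', p''#} + P'" "Q = {#q, q', q''#} + Q'" "R = add_mset r R'"
    using ex3[OF assms(2)] ex3[OF assms(3)] ex3[OF assms(4)] by auto
  interpret first: symmetrised_relations n m J "\<lambda>A B C. f B A C" by (rule swap_first)
  interpret last: symmetrised_relations n m J "\<lambda>A B C. f A C B" by (rule swap_last)
  \<comment> \<open>\<open>c\<close>, \<open>d\<close> are the two cyclic moves, and \<open>tpq\<close>, \<open>tpr\<close>, \<open>tqr\<close> the exchanges between two blocks\<close>
  define c where "c x y = f (add_mset r (P - {#x#})) (add_mset x (Q - {#y#})) (add_mset y R')" for x y
  define d where "d x y = f (add_mset y (P - {#x#})) (add_mset r (Q - {#y#})) (add_mset x R')" for x y
  define tpq where "tpq x y = f (add_mset y (P - {#x#})) (add_mset x (Q - {#y#})) R" for x y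
  define tpr where "tpr x = f (add_mset r (P - {#x#})) Q (add_mset x R')" for x
  define tqr where "tqr y = f P (add_mset r (Q - {#y#})) (add_mset y R')" for y
  \<comment> \<open>summation over the three letters singled out in \<open>P\<close>, respectively \<open>Q\<close>\<close>
  define S where "S u = u p + u p' + u p''" for u :: "nat \<Rightarrow> 'b"
  define T where "T u = u q + u q' + u q''" for u :: "nat \<Rightarrow> 'b"
  have ST: "T (\<lambda>y. S (\<lambda>x. u x y)) = S (\<lambda>x. T (u x))" for u
    by (simp add: S_def T_def algebra_simps)
  have Sadd: "S (\<lambda>x. u x + v x) = S u + S v" "T (\<lambda>x. u x + v x) = T u + T v" for u v
    by (simp_all add: S_def T_def algebra_simps)
  have Sk: "S (\<lambda>_. k) = k + k + k" "T (\<lambda>_. k) = k + k + k" for k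
    by (simp_all add: S_def T_def)
  have SJ: "S u \<in> J" if "\<And>x. x \<in> {p,p',p''} \<Longrightarrow> u x \<in> J" for u
    using that by (auto simp: S_def intro!: add)
  have TJ: "T u \<in> J" if "\<And>x. x \<in> {q,q',q''} \<Longrightarrow> u x \<in> J" for u
    using that by (auto simp: T_def intro!: add)
  have Qd: "Q = add_mset y (Q - {#y#})" if "y \<in> {q,q',q''}" for y using that PQR(2) by auto
  have Pd: "P = add_mset y (P - {#y#})" if "y \<in> {p,p',p''}" for y using that PQR(1) by auto
  have D: "T (\<lambda>y. S (\<lambda>x. d x y)) \<in> J"
    using cycle[OF PQR assms(2-4)] by (simp add: S_def T_def d_def)
  have C: "S (\<lambda>x. T (c x)) \<in> J"
    using first.cycle[OF PQR(2,1,3) assms(3,2,4)] by (simp add: S_def T_def c_def)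
  have TPR: "S tpr + S (\<lambda>x. c x y) \<in> J" if "y \<in> {q,q',q''}" for y
    using swap_plus_cycle[OF PQR(1) Qd[OF that] PQR(3) assms(2-4)]
    by (simp add: S_def c_def tpr_def algebra_simps)
  have TQR: "T tqr + T (d x) \<in> J" if "x \<in> {p,p',p''}" for x
    using first.swap_plus_cycle[OF PQR(2) Pd[OF that] PQR(3) assms(3,2,4)]
    by (simp add: T_def d_def tqr_def algebra_simps)
  have TPQ: "S (\<lambda>x. tpq x y) + S (\<lambda>x. d x y) \<in> J" if "y \<in> {q,q',q''}" for y
    using last.swap_plus_cycle[OF PQR(1,3) Qd[OF that] assms(2,4,3)]
    by (simp add: S_def d_def tpq_def algebra_simps)
  have E: "f P Q R + tpq x y + tpr x + tqr y + c x y + d x y \<in> J"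
    if "x \<in> {p,p',p''}" "y \<in> {q,q',q''}" for x y
  proof -
    have "P - {#x#} \<in> msets n m" "Q - {#y#} \<in> msets n m" "R' \<in> msets n m" "{x,y,r} \<subseteq> {1..n}"
      using assms(2-4) PQR that by (auto simp: msets_def)
    from relation[OF this] show ?thesis
      using Pd[OF that(1)] Qd[OF that(2)] PQR(3)
      by (simp add: c_def d_def tpq_def tpr_def tqr_def algebra_simps)
  qed
  have 1: "S tpr \<in> J"
  proof -
    have "T (\<lambda>y. S tpr + S (\<lambda>x. c x y)) \<in> J" by (rule TJ) (rule TPR)
    then show ?thesis by - (rule third[OF cancel[OF _ C]], simp add: Sadd Sk ST)
  qed
  have 2: "T tqr \<in> J"
  proof -
    have "S (\<lambda>x. T tqr + T (d x)) \<in> J" by (rule SJ) (rule TQR)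
    then show ?thesis by - (rule third[OF cancel[OF _ D]], simp add: Sadd Sk ST)
  qed
  have 3: "T (\<lambda>y. S (\<lambda>x. tpq x y)) \<in> J"
  proof -
    have "T (\<lambda>y. S (\<lambda>x. tpq x y) + S (\<lambda>x. d x y)) \<in> J" by (rule TJ) (rule TPQ)
    then show ?thesis by - (rule cancel[OF _ D], simp add: Sadd)
  qed
  \<comment> \<open>\<open>k\<close> collects the five terms to be removed; \<open>tpr\<close> and \<open>tqr\<close> depend on one letter, hence the multiplicity \<open>3\<close>\<close>
  define k where "k = T (\<lambda>y. S (\<lambda>x. tpq x y)) + (S tpr + S tpr + S tpr)
    + S (\<lambda>_. T tqr) + S (\<lambda>x. T (c x)) + T (\<lambda>y. S (\<lambda>x. d x y))"
  have K: "k \<in> J" unfolding k_def Sk by (intro add 1 2 3 C D)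
  have "T (\<lambda>y. S (\<lambda>x. f P Q R + tpq x y + tpr x + tqr y + c x y + d x y)) \<in> J"
    by (intro TJ SJ E)
  also have "T (\<lambda>y. S (\<lambda>x. f P Q R + tpq x y + tpr x + tqr y + c x y + d x y)) =
     T (\<lambda>_. S (\<lambda>_. f P Q R)) + k"
    by (simp add: Sadd Sk ST k_def algebra_simps)
  finally have "T (\<lambda>_. S (\<lambda>_. f P Q R)) \<in> J" using K by (rule cancel)
  then show ?thesis by - (rule third[OF third], simp add: Sk add.assoc)
qed

end

section \<open>Inclusions between the ideals\<close>

lemma cat_ideal_shift:
  assumes "b \<ge> 2"
  shows "(cat_ideal 3 a (Suc b) n :: 'k::field_char_0 zpoly set) \<subseteq> cat_ideal 3 (Suc a) b n"
proof (rule cat_ideal_least)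
  let ?J = "cat_ideal 3 (Suc a) b n :: 'k zpoly set"
  have J: "ideal ?J (poly_ring n (Suc a + b) :: 'k zpoly ring)" by (rule ideal_cat_ideal)
  then show "ideal ?J (poly_ring n (a + Suc b) :: 'k zpoly ring)" by simp
  fix \<alpha> \<alpha>' \<alpha>'' \<beta> \<beta>' \<beta>''
  assume \<alpha>: "{\<alpha>, \<alpha>', \<alpha>''} \<subseteq> msets n a" and \<beta>: "{\<beta>, \<beta>', \<beta>''} \<subseteq> msets n (Suc b)"
  interpret symmetrised_relations n b ?J "cat_minor \<alpha> \<alpha>' \<alpha>''"
  proof
    fix u :: "'k zpoly"
    have "2 * u = u + u" "3 * u = u + u + u"
      by (simp_all only: numeral.simps distrib_right mult_1_left)
    then show "u + u \<in> ?J \<Longrightarrow> u \<in> ?J" "u + u + u \<in> ?J \<Longrightarrow> u \<in> ?J"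
      using ideal_cancel_numeral[OF J] by metis+
  next
    fix A B C x y z
    assume ABC: "A \<in> msets n b" "B \<in> msets n b" "C \<in> msets n b" "{x, y, z} \<subseteq> {1..n}"
    have "add_mset t \<gamma> \<in> msets n (Suc a)" if "t \<in> {x, y, z}" "\<gamma> \<in> {\<alpha>, \<alpha>', \<alpha>''}" for t \<gamma>
      using that ABC(4) \<alpha> by (auto simp: msets_def)
    then show "cat_minor \<alpha> \<alpha>' \<alpha>'' (add_mset x A) (add_mset y B) (add_mset z C)
      + cat_minor \<alpha> \<alpha>' \<alpha>'' (add_mset x A) (add_mset z B) (add_mset y C)
      + cat_minor \<alpha> \<alpha>' \<alpha>'' (add_mset y A) (add_mset x B) (add_mset z C)
      + cat_minor \<alpha> \<alpha>' \<alpha>'' (add_mset y A) (add_mset z B) (add_mset x C)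
      + cat_minor \<alpha> \<alpha>' \<alpha>'' (add_mset z A) (add_mset x B) (add_mset y C)
      + cat_minor \<alpha> \<alpha>' \<alpha>'' (add_mset z A) (add_mset y B) (add_mset x C) \<in> ?J"
      unfolding sum_cat_minor_move_letters
      by (intro ideal_closed(1)[OF J] cat_minor_in_cat_ideal) (use ABC in auto)
  qed (fact ideal_closed[OF J])+
  show "cat_minor \<alpha> \<alpha>' \<alpha>'' \<beta> \<beta>' \<beta>'' \<in> ?J"
    using \<beta> by (intro all_values_in_J assms) auto
qed

lemma cat_ideal_mono:
  assumes "a \<le> a'" "a' + 2 \<le> d"
  shows "(cat_ideal 3 a (d - a) n :: 'k::field_char_0 zpoly set) \<subseteq> cat_ideal 3 a' (d - a') n"
  using assms
proof (induction a' rule: dec_induct)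
  case (step k)
  then have "(cat_ideal 3 k (Suc (d - Suc k)) n :: 'k zpoly set) \<subseteq> cat_ideal 3 (Suc k) (d - Suc k) n"
    by (intro cat_ideal_shift) simp
  moreover have "Suc (d - Suc k) = d - k" using step by simp
  ultimately show ?case using step by auto
qed simp

section \<open>Strictness\<close>

text \<open>
  This is the kernel of the evaluation that sends \<open>z\<^sub>\<gamma>\<close> to an indeterminate and all other variables to \<open>0\<close>:
  the monomials that survive it, the constant one included, are the powers of \<open>z\<^sub>\<gamma>\<close>.
\<close>

definition no_pure_powers :: "nat \<Rightarrow> nat \<Rightarrow> nat multiset \<Rightarrow> 'k::comm_ring_1 zpoly set" where
  "no_pure_powers n d \<gamma> =
     {p \<in> carrier (poly_ring n d). \<forall>m \<in> Poly_Mapping.keys p. \<not> Poly_Mapping.keys m \<subseteq> {\<gamma>}}"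

lemma ideal_no_pure_powers:
  "ideal (no_pure_powers n d \<gamma>) (poly_ring n d :: 'k::comm_ring_1 zpoly ring)"
proof -
  interpret cring "poly_ring n d :: 'k zpoly ring" by (rule cring_poly_ring)
  let ?S = "poly_ring n d :: 'k zpoly ring" and ?I = "no_pure_powers n d \<gamma> :: 'k zpoly set"
  have neg: "\<ominus>\<^bsub>?S\<^esub> p = - p" if "p \<in> carrier ?S" for p
    using that by (intro minus_equality) (auto simp: poly_ring_def in_keys_iff)
  have add: "p + q \<in> ?I" if "p \<in> ?I" "q \<in> ?I" for p q
    using that a_closed[of p q] Poly_Mapping.keys_add[of p q]
    by (auto simp: no_pure_powers_def)
  have mult: "p * q \<in> ?I" if "p \<in> ?I" "q \<in> carrier ?S" for p q
  proof -
    have "\<not> Poly_Mapping.keys m \<subseteq> {\<gamma>}" if m: "m \<in> Poly_Mapping.keys (p * q)" for m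
    proof -
      obtain u v where uv: "m = u + v" "u \<in> Poly_Mapping.keys p"
        using keys_mult[of p q] m by blast
      then have "Poly_Mapping.keys u \<subseteq> Poly_Mapping.keys m"
        by (auto simp: in_keys_iff lookup_add)
      then show ?thesis
        using uv(2) \<open>p \<in> ?I\<close> by (auto simp: no_pure_powers_def)
    qed
    then show ?thesis
      using that m_closed[of p q] by (auto simp: no_pure_powers_def)
  qed
  show ?thesis
  proof (rule idealI)
    show "subgroup ?I (add_monoid ?S)"
    proof
      show "?I \<subseteq> carrier (add_monoid ?S)" by (auto simp: no_pure_powers_def)
      show "\<one>\<^bsub>add_monoid ?S\<^esub> \<in> ?I" by (simp add: no_pure_powers_def poly_ring_def)
      fix p q assume "p \<in> ?I" "q \<in> ?I"
      then show "p \<otimes>\<^bsub>add_monoid ?S\<^esub> q \<in> ?I" by (simp add: add)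
    next
      fix p assume "p \<in> ?I"
      then show "inv\<^bsub>add_monoid ?S\<^esub> p \<in> ?I"
        using neg[of p] a_inv_closed[of p] unfolding a_inv_def[symmetric]
        by (simp add: no_pure_powers_def in_keys_iff)
    qed
  qed (auto simp: mult mult.commute ring_axioms)
qed

lemma zvar_cube_mem_no_pure_powers:
  assumes "{\<delta>, \<delta>', \<delta>''} \<subseteq> msets n d"
  shows "zvar \<delta> * zvar \<delta>' * zvar \<delta>'' \<in> (no_pure_powers n d \<gamma> :: 'k::comm_ring_1 zpoly set)
    \<longleftrightarrow> \<not> {\<delta>, \<delta>', \<delta>''} \<subseteq> {\<gamma>}"
proof -
  let ?m = "Poly_Mapping.single \<delta> 1 + Poly_Mapping.single \<delta>' 1 + Poly_Mapping.single \<delta>'' (1::nat)"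
  have "zvar \<delta> * zvar \<delta>' * zvar \<delta>'' = (Poly_Mapping.single ?m 1 :: 'k zpoly)"
    by (simp add: zvar_def mult_single)
  moreover have "Poly_Mapping.keys ?m = {\<delta>, \<delta>', \<delta>''}"
    by (auto simp: in_keys_iff lookup_add lookup_single when_def split: if_splits)
  ultimately show ?thesis
    using assms by (auto simp: no_pure_powers_def poly_ring_def)
qed

text \<open>
  Each product in a minor of \<open>Cat(1, e)\<close> has a factor from each of three distinct rows, but only
  the rows of the letters \<open>1\<close> and \<open>2\<close> can contain \<open>z\<^sub>\<gamma>\<close>.
\<close>

lemma cat_ideal_1_subset:
  assumes "set_mset \<gamma> \<subseteq> {1, 2}"
  shows "(cat_ideal 3 1 e n :: 'k::comm_ring_1 zpoly set) \<subseteq> no_pure_powers n (1 + e) \<gamma>"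
proof (rule cat_ideal_least)
  let ?N = "no_pure_powers n (1 + e) \<gamma> :: 'k zpoly set"
  show I: "ideal ?N (poly_ring n (1 + e) :: 'k zpoly ring)" by (rule ideal_no_pure_powers)
  fix \<alpha> \<alpha>' \<alpha>'' \<beta> \<beta>' \<beta>''
  assume \<alpha>: "distinct [\<alpha>, \<alpha>', \<alpha>'']" "{\<alpha>, \<alpha>', \<alpha>''} \<subseteq> msets n 1" and \<beta>: "{\<beta>, \<beta>', \<beta>''} \<subseteq> msets n e"
  have small: "\<delta> = {#1#} \<or> \<delta> = {#2#}" if \<delta>: "\<delta> + \<epsilon> = \<gamma>" "\<delta> \<in> msets n 1" for \<delta> \<epsilon>
  proof -
    obtain x where "\<delta> = {#x#}" using \<delta>(2) size_1_singleton_mset[of \<delta>] by (auto simp: msets_def)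
    then show ?thesis using \<delta>(1) assms by auto
  qed
  have cube: "cat_entry \<alpha> \<delta> * cat_entry \<alpha>' \<delta>' * cat_entry \<alpha>'' \<delta>'' \<in> ?N"
    if "{\<delta>, \<delta>', \<delta>''} \<subseteq> {\<beta>, \<beta>', \<beta>''}" for \<delta> \<delta>' \<delta>''
  proof -
    have "{\<alpha> + \<delta>, \<alpha>' + \<delta>', \<alpha>'' + \<delta>''} \<subseteq> msets n (1 + e)"
      using \<alpha>(2) \<beta> that by (auto simp: msets_def)
    moreover have "\<not> {\<alpha> + \<delta>, \<alpha>' + \<delta>', \<alpha>'' + \<delta>''} \<subseteq> {\<gamma>}"
      using small[of \<alpha> \<delta>] small[of \<alpha>' \<delta>'] small[of \<alpha>'' \<delta>''] \<alpha> by auto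
    ultimately show ?thesis unfolding cat_entry_def by (simp only: zvar_cube_mem_no_pure_powers simp_thms)
  qed
  show "cat_minor \<alpha> \<alpha>' \<alpha>'' \<beta> \<beta>' \<beta>'' \<in> ?N"
    unfolding cat_minor_def by (intro ideal_closed(1,2)[OF I] cube) auto
qed

text \<open>
  The witness is the Hankel minor with rows \<open>11\<close>, \<open>12\<close>, \<open>22\<close> and columns \<open>1\<^sup>e11\<close>, \<open>1\<^sup>e12\<close>, \<open>1\<^sup>e22\<close>. Its antidiagonal
  product is \<open>z\<^sub>\<gamma>\<^sup>3\<close>, and every other product in it has a factor different from \<open>z\<^sub>\<gamma>\<close>.
\<close>

lemma cat_ideal_2_not_subset:
  assumes "n \<ge> 2" "\<gamma> = replicate_mset (e + 2) 1 + {#2, 2#}"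
  shows "\<not> (cat_ideal 3 2 (e + 2) n :: 'k::comm_ring_1 zpoly set) \<subseteq> no_pure_powers n (e + 4) \<gamma>"
proof
  let ?N = "no_pure_powers n (e + 4) \<gamma> :: 'k zpoly set"
  have I: "ideal ?N (poly_ring n (e + 4) :: 'k zpoly ring)" by (rule ideal_no_pure_powers)
  define E where "E = replicate_mset e (1::nat)"
  have \<gamma>: "\<gamma> = E + {#1, 1, 2, 2#}" by (simp add: assms(2) E_def)
  have E: "E \<in> msets n e" using assms(1) by (auto simp: E_def msets_def)
  define M where "M = (cat_minor {#1,1#} {#1,2#} {#2,2#} (E + {#1,1#}) (E + {#1,2#}) (E + {#2,2#}) :: 'k zpoly)"
  assume "cat_ideal 3 2 (e + 2) n \<subseteq> ?N"
  moreover have "M \<in> cat_ideal 3 2 (e + 2) n" unfolding M_def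
    using assms(1) E by (intro cat_minor_in_cat_ideal) (auto simp: msets_def)
  ultimately have M: "M \<in> ?N" by blast
  have other: "zvar \<delta> * zvar \<delta>' * zvar \<delta>'' \<in> ?N"
    if "{\<delta>, \<delta>', \<delta>''} \<subseteq> msets n (e + 4)" "\<delta> \<noteq> \<gamma> \<or> \<delta>' \<noteq> \<gamma> \<or> \<delta>'' \<noteq> \<gamma>" for \<delta> \<delta>' \<delta>''
    using that by (auto simp: zvar_cube_mem_no_pure_powers)
  define z where "z k = (zvar (E + k) :: 'k zpoly)" for k
  have z: "z k * z k' * z k'' \<in> ?N"
    if "{k, k', k''} \<subseteq> msets n 4" "k \<noteq> {#1,1,2,2#} \<or> k' \<noteq> {#1,1,2,2#} \<or> k'' \<noteq> {#1,1,2,2#}" for k k' k''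
    unfolding z_def using that E by (intro other) (auto simp: msets_def \<gamma>)
  have "M + z {#1,1,2,2#} * z {#1,1,2,2#} * z {#1,1,2,2#} =
     z {#1,1,1,1#} * z {#1,1,2,2#} * z {#2,2,2,2#} + z {#1,1,1,2#} * z {#1,2,2,2#} * z {#1,1,2,2#}
     + z {#1,1,2,2#} * z {#1,1,1,2#} * z {#1,2,2,2#} - z {#1,1,1,1#} * z {#1,2,2,2#} * z {#1,2,2,2#}
     - z {#1,1,1,2#} * z {#1,1,1,2#} * z {#2,2,2,2#}"
    by (simp add: M_def cat_minor_def cat_entry_def z_def add_mset_commute)
  also have "\<dots> \<in> ?N"
    using assms(1) by (intro ideal_closed(1,2)[OF I] z) (auto simp: msets_def add_eq_conv_diff)
  finally have "z {#1,1,2,2#} * z {#1,1,2,2#} * z {#1,1,2,2#} \<in> ?N"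
    using ideal_closed(2)[OF I _ M] by fastforce
  then show False
    using assms(1) E unfolding z_def
    by (subst (asm) zvar_cube_mem_no_pure_powers) (auto simp: \<gamma> msets_def)
qed

theorem theorem5p1:
  fixes n d :: nat
  assumes "n \<ge> 2" and "d \<ge> 4"
  shows "(\<forall>t. 2 \<le> t \<and> t \<le> d - 2 \<longrightarrow>
            (cat_ideal 3 2 (d - 2) n :: 'k::field_char_0 zpoly set) = cat_ideal 3 t (d - t) n)
       \<and> (cat_ideal 3 1 (d - 1) n :: 'k zpoly set) \<subset> cat_ideal 3 2 (d - 2) n"
proof (intro conjI allI impI)
  fix t assume t: "2 \<le> t \<and> t \<le> d - 2"
  have "(cat_ideal 3 t (d - t) n :: 'k zpoly set) \<subseteq> cat_ideal 3 (d - 2) (d - (d - 2)) n"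
    using t assms(2) by (intro cat_ideal_mono) auto
  also have "\<dots> = cat_ideal 3 2 (d - 2) n"
    using assms(2) by (simp add: cat_ideal_transpose[of "d - 2"])
  finally have "(cat_ideal 3 t (d - t) n :: 'k zpoly set) \<subseteq> cat_ideal 3 2 (d - 2) n" .
  moreover have "(cat_ideal 3 2 (d - 2) n :: 'k zpoly set) \<subseteq> cat_ideal 3 t (d - t) n"
    using t by (intro cat_ideal_mono) auto
  ultimately show "(cat_ideal 3 2 (d - 2) n :: 'k zpoly set) = cat_ideal 3 t (d - t) n"
    by blast
next
  define \<gamma> :: "nat multiset" where "\<gamma> = replicate_mset (d - 2) 1 + {#2, 2#}"
  obtain e where e: "d = e + 4" using assms(2) by (metis add.commute le_Suc_ex)
  have "(cat_ideal 3 1 (d - 1) n :: 'k zpoly set) \<subseteq> no_pure_powers n d \<gamma>"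
    using cat_ideal_1_subset[of \<gamma> "d - 1" n] assms(2) by (auto simp: \<gamma>_def)
  moreover have "\<not> (cat_ideal 3 2 (d - 2) n :: 'k zpoly set) \<subseteq> no_pure_powers n d \<gamma>"
    using cat_ideal_2_not_subset[OF assms(1), of \<gamma> e] by (simp add: e \<gamma>_def)
  moreover have "(cat_ideal 3 1 (d - 1) n :: 'k zpoly set) \<subseteq> cat_ideal 3 2 (d - 2) n"
    using assms(2) by (intro cat_ideal_mono) auto
  ultimately show "(cat_ideal 3 1 (d - 1) n :: 'k zpoly set) \<subset> cat_ideal 3 2 (d - 2) n"
    by blast
qed

end
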